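(* Let $s\ge 1$ and $k\ge 2$ be integers, and let $p_1,\dots,p_k\ge 1$ be integers with $\sum_{i=1}^k p_i=4s$. Consider decks of $4s$ cards containing exactly $p_i$ cards of colour $P_i$ for $i=1,\dots,k$. Write $B=P_1$ (black), $R=P_2$ (red) and $b=p_1$. Fix an arbitrary dealing method for four players $N,E,S,W$, i.e. a word of length $4s$ in the letters $N,E,S,W$ in which each letter occurs exactly $s$ times. Let $\omega=(p_{i,J})_{1\le i\le k,\;J\in\{N,E,S,W\}}\in\Omega$ be a hand. For $J\in\{N,E,S,W\}$ put $b_J=p_{1,J}$ and $p_J=\sum_{i=3}^k p_{i,J}$ (the number of non-red and non-black cards received by $J$), and let $J_1<J_2<\dots<J_s$ be the positions of the letter $J$ in the dealing word. Then $$ \begin{aligned} \sum_{D'\in\mathcal D(\omega)} Z(D',B,R) =\;& s!^4\Bigl(\prod_{i=1}^{k}\frac{1}{p_{i,N}!\,p_{i,E}!\,p_{i,S}!\,p_{i,W}!}\Bigr)\cdot\Bigl((4s+1)b\\ &+\frac{b_N}{s}\Bigl(\frac{p_E Z(E,N)+p_S Z(S,N)+p_W Z(W,N)}{s}-2\sum_{t=1}^s N_t\Bigr)\\ &+\frac{b_E}{s}\Bigl(\frac{p_N Z(N,E)+p_S Z(S,E)+p_W Z(W,E)}{s}-2\sum_{t=1}^s E_t\Bigr)\\ &+\frac{b_S}{s}\Bigl(\frac{p_N Z(N,S)+p_E Z(E,S)+p_W Z(W,S)}{s}-2\sum_{t=1}^s S_t\Bigr)\\ &+\frac{b_W}{s}\Bigl(\frac{p_N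 Z(N,W)+p_E Z(E,W)+p_S Z(S,W)}{s}-2\sum_{t=1}^s W_t\Bigr)\Bigr). \end{aligned} $$
   Context: A deck is an ordered sequence of cards $D'=(D'(1),\dots,D'(4s))$, where $D'(m)$ is the colour of the card in position $m$; cards of the same colour are indistinguishable. All decks considered have exactly $p_i$ cards of colour $P_i$. For colours $u\ne v$, a $u$-$v$ pair in $D'$ is a pair of positions $(m,m')$ with $m<m'$, $D'(m)=u$, $D'(m')=v$, and $$Z(D',u,v)=\#\{u\text{-}v\text{ pairs in }D'\}-\#\{v\text{-}u\text{ pairs in }D'\}.$$ A dealing word determines which player receives the card in each position of the deck: the card in position $m$ goes to the player given by the $m$-th letter. For players $I\neq J$, $$Z(I,J)=\#\{I\text{-}J\text{ pairs in the dealing word}\}-\#\{J\text{-}I\text{ pairs in the dealing word}\},$$ where an $I$-$J$ pair in the word is a pair of positions $m<m'$ with letter $I$ at $m$ and letter $J$ at $m'$. The set $\Omega$ of hands consists of all families of non-negative integers $(p_{i,J})_{1\le i\le k,\,J\in\{N,E,S,W\}}$ with $\sum_{i=1}^k p_{i,J}=s$ for each player $J$ and $p_{i,N}+p_{i,E}+p_{i,S}+p_{i,W}=p_i$ for each $i$; here $p_{i,J}$ is the number of cards of colour $P_i$ received by player $J$. For $\omega\in\Omega$, $\mathcal D(\omega)$ denotes the set of all decks $D'$ that give the hand $\omega$ when dealt according to the fixed dealing word, i.e. for which each player $J$ receives exactly $p_{i,J}$ cards of colour $P_i$ for every $i$. *)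

theory Defs
  imports Complex_Main
begin

datatype player = North | East | South | West

text \<open>Decks and dealing words are lists. The card in position \<open>m\<close>, counted from 1, is the list
  entry with index \<open>m - 1\<close>. The colours \<open>P_1, ..., P_k\<close> are the numbers \<open>1, ..., k\<close>.\<close>

definition is_deck :: "nat \<Rightarrow> nat \<Rightarrow> (nat \<Rightarrow> nat) \<Rightarrow> nat list \<Rightarrow> bool" where
  "is_deck s k p D \<longleftrightarrow>
     length D = 4 * s \<and> set D \<subseteq> {1..k} \<and> (\<forall>i\<in>{1..k}. count_list D i = p i)"

definition is_dealing_word :: "nat \<Rightarrow> player list \<Rightarrow> bool" where
  "is_dealing_word s w \<longleftrightarrow> length w = 4 * s \<and> (\<forall>J. count_list w J = s)"

text \<open>The following two notions do not depend on the offset of the indices, and serve both for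
  decks (pairs of colours) and for dealing words (pairs of players).\<close>

definition pairs :: "'a list \<Rightarrow> 'a \<Rightarrow> 'a \<Rightarrow> (nat \<times> nat) set" where
  "pairs xs u v = {(m, m'). m < m' \<and> m' < length xs \<and> xs ! m = u \<and> xs ! m' = v}"

definition Z :: "'a list \<Rightarrow> 'a \<Rightarrow> 'a \<Rightarrow> int" where
  "Z xs u v = int (card (pairs xs u v)) - int (card (pairs xs v u))"

text \<open>Families indexed by \<open>{1..k}\<close> are extended by 0, so that each one is represented exactly once.\<close>

definition Omega :: "nat \<Rightarrow> nat \<Rightarrow> (nat \<Rightarrow> nat) \<Rightarrow> (nat \<Rightarrow> player \<Rightarrow> nat) set" where
  "Omega s k p = {\<omega>.
     (\<forall>J. (\<Sum>i=1..k. \<omega> i J) = s) \<and>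
     (\<forall>i\<in>{1..k}. \<omega> i North + \<omega> i East + \<omega> i South + \<omega> i West = p i) \<and>
     (\<forall>i J. i \<notin> {1..k} \<longrightarrow> \<omega> i J = 0)}"

definition cards_received :: "player list \<Rightarrow> nat list \<Rightarrow> nat \<Rightarrow> player \<Rightarrow> nat" where
  "cards_received w D i J = card {m. m < length w \<and> w ! m = J \<and> D ! m = i}"

definition decks_giving ::
  "nat \<Rightarrow> nat \<Rightarrow> (nat \<Rightarrow> nat) \<Rightarrow> player list \<Rightarrow> (nat \<Rightarrow> player \<Rightarrow> nat) \<Rightarrow> nat list set" where
  "decks_giving s k p w \<omega> =
     {D. is_deck s k p D \<and> (\<forall>i\<in>{1..k}. \<forall>J. cards_received w D i J = \<omega> i J)}"

text \<open>\<open>letter_pos w J t\<close> is \<open>J_t\<close>: the \<open>t\<close>-th smallest position of \<open>J\<close> in \<open>w\<close>, where both \<open>t\<close> and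
  the position are counted from 1.\<close>

definition letter_pos :: "player list \<Rightarrow> player \<Rightarrow> nat \<Rightarrow> nat" where
  "letter_pos w J t = filter (\<lambda>m. w ! (m - 1) = J) [1..<length w + 1] ! (t - 1)"

end

theory Submission
  imports Defs "HOL-Combinatorics.Permutations"
begin

text \<open>Exchanging two cards dealt to the same player permutes the decks giving \<open>\<omega>\<close>. Hence the number
  of decks with colours \<open>u\<close>, \<open>v\<close> at positions dealt to distinct players \<open>I\<close>, \<open>J\<close> is
  \<open>\<omega> u I * \<omega> v J / s\<^sup>2\<close> times the number of all decks, and positions of the same player contribute
  nothing to the sum of \<open>Z D B R\<close>, which becomes the sum of \<open>\<omega> B I * \<omega> R J * Z w I J\<close> up to that
  factor. Writing \<open>\<omega> R J\<close> as \<open>s - \<omega> B J - q J\<close>, the \<open>s\<close> term is evaluated by summing \<open>Z w I J\<close> over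
  \<open>J\<close>, and the \<open>\<omega> B J\<close> term vanishes by antisymmetry of \<open>Z\<close>.\<close>

section \<open>Sums over the four players and over pairs of positions\<close>

lemma UNIV_player: "UNIV = {North, East, South, West}"
  using player.exhaust by auto

lemma finite_player [simp]: "finite (A :: player set)"
  by (rule finite_subset[OF subset_UNIV]) (simp add: UNIV_player)

lemma sum_player: "(\<Sum>J\<in>UNIV. g J) = g North + g East + g South + g West"
  for g :: "player \<Rightarrow> 'a :: comm_monoid_add"
  by (simp add: UNIV_player algebra_simps)

lemma prod_player: "(\<Prod>J\<in>UNIV. g J) = g North * g East * g South * g West"
  for g :: "player \<Rightarrow> 'a :: comm_monoid_mult"
  by (simp add: UNIV_player algebra_simps)

lemma card_conv_sum_of_bool:
  "finite A \<Longrightarrow> of_nat (card {x\<in>A. P x}) = (\<Sum>x\<in>A. of_bool (P x) :: 'a :: semiring_1)"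
  by (simp add: of_bool_def sum.If_cases Int_def)

lemma card_pairs:
  "of_nat (card (pairs xs u v)) =
     (\<Sum>n<length xs. \<Sum>m<n. of_bool (xs ! m = u \<and> xs ! n = v) :: 'a :: semiring_1)"
proof -
  \<comment> \<open>The later position becomes the outer index, so that the pairs form a triangular
    sum with inner range \<open>m < n\<close>; \<open>prod.swap\<close> restores the order of the
    components.\<close>
  have "pairs xs u v = prod.swap ` (SIGMA n:{..<length xs}. {m\<in>{..<n}. xs ! m = u \<and> xs ! n = v})"
    by (force simp: pairs_def image_iff)
  then have "card (pairs xs u v) =
      (\<Sum>n<length xs. card {m\<in>{..<n}. xs ! m = u \<and> xs ! n = v})"
    by (simp add: card_image)
  then show ?thesis
    using card_conv_sum_of_bool[OF finite_lessThan, where 'a='a] by simp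
qed

lemma sum_swap_triangle:
  "(\<Sum>J\<in>A. \<Sum>n<L. \<Sum>m<n. h J n m) = (\<Sum>n<L. \<Sum>m<n. \<Sum>J\<in>A. h J n m)"
  for L :: nat and h :: "_ \<Rightarrow> _ \<Rightarrow> _ \<Rightarrow> 'a :: comm_monoid_add"
  by (subst sum.swap, rule sum.cong[OF refl], rule sum.swap)

lemma Z_conv_sum:
  "of_int (Z xs u v) = (\<Sum>n<length xs. \<Sum>m<n.
     of_bool (xs ! m = u \<and> xs ! n = v) - of_bool (xs ! m = v \<and> xs ! n = u) :: 'a :: ring_1)"
  by (simp add: Z_def card_pairs sum_subtractf)

lemma Z_antisym: "Z xs u v = - Z xs v u"
  by (simp add: Z_def)

lemma count_list_conv_card: "count_list xs x = card {m. m < length xs \<and> xs ! m = x}"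
  by (simp add: count_list_eq_length_filter length_filter_conv_card)
     (metis (mono_tags))

section \<open>Row sums of \<open>Z\<close> for the dealing word, in terms of letter
  positions\<close>

text \<open>Summing over \<open>J\<close> forgets the second letter. An occurrence of
  \<open>I\<close> at index \<open>m\<close> has \<open>length w - 1 - m\<close> entries after it
  and \<open>m\<close> entries before it, and contributes the difference.\<close>

lemma sum_Z_UNIV:
  fixes w :: "'a list"
  assumes "finite (UNIV :: 'a set)"
  shows "(\<Sum>J\<in>UNIV. Z w I J) =
    (\<Sum>m | m < length w \<and> w ! m = I. int (length w) - 1 - 2 * int m)"
proof -
  define L where "L = length w"
  have one: "(\<Sum>J\<in>UNIV. of_bool (P \<and> x = J)) = (of_bool P :: int)" for P and x :: 'a
    using assms by (cases P) (simp_all add: of_bool_def)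
  have one': "(\<Sum>J\<in>UNIV. of_bool (x = J \<and> P)) = (of_bool P :: int)" for P and x :: 'a
    using one[of P x] by (simp add: conj_commute)
  have "(\<Sum>J\<in>UNIV. Z w I J) = (\<Sum>J\<in>UNIV. \<Sum>n<L. \<Sum>m<n.
      of_bool (w ! m = I \<and> w ! n = J) - of_bool (w ! m = J \<and> w ! n = I))"
    using Z_conv_sum[where 'a=int and xs=w] by (simp add: L_def)
  also have "\<dots> = (\<Sum>n<L. \<Sum>m<n. \<Sum>J\<in>UNIV.
      of_bool (w ! m = I \<and> w ! n = J) - of_bool (w ! m = J \<and> w ! n = I))"
    by (rule sum_swap_triangle)
  also have "\<dots> = (\<Sum>n<L. \<Sum>m<n. of_bool (w ! m = I)) - (\<Sum>n<L. \<Sum>m<n. of_bool (w ! n = I))"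
    by (simp only: sum_subtractf one one')
  \<comment> \<open>Counting by columns: a fixed \<open>m\<close> lies below exactly
    \<open>L - 1 - m\<close> of the indices \<open>n < L\<close>.\<close>
  also have "(\<Sum>n<L. \<Sum>m<n. of_bool (w ! m = I)) =
      (\<Sum>m<L. (int L - 1 - int m) * of_bool (w ! m = I))"
    by (induction L) (simp_all add: algebra_simps sum.distrib sum_subtractf)
  also have "(\<Sum>m<L. (int L - 1 - int m) * of_bool (w ! m = I)) - (\<Sum>n<L. \<Sum>m<n. of_bool (w ! n = I))
      = (\<Sum>m<L. (int L - 1 - 2 * int m) * of_bool (w ! m = I))"
    unfolding sum_subtractf[symmetric]
  proof (intro sum.cong refl)
    show "(int L - 1 - int m) * of_bool (w ! m = I) - (\<Sum>_<m. of_bool (w ! m = I)) =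
      (int L - 1 - 2 * int m) * of_bool (w ! m = I)" for m
      by (cases "w ! m = I") simp_all
  qed
  also have "\<dots> = (\<Sum>m\<in>{m\<in>{..<L}. w ! m = I}. int L - 1 - 2 * int m)"
    by (subst sum.inter_filter[of "{..<L}"], simp, intro sum.cong refl) simp
  finally show ?thesis by (simp add: L_def)
qed

text \<open>The positions form a list without repetitions, so the sum of its entries depends only on
  its set, which consists of the list indices shifted by one.\<close>

lemma sum_letter_pos:
  "(\<Sum>t=1..count_list w J. letter_pos w J t) = (\<Sum>m | m < length w \<and> w ! m = J. m + 1)"
proof -
  define ps where "ps = filter (\<lambda>m. w ! (m - 1) = J) [1..<length w + 1]"
  have set_ps: "set ps = Suc ` {m. m < length w \<and> w ! m = J}"
  proof (intro equalityI subsetI)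
    fix n assume "n \<in> set ps"
    then show "n \<in> Suc ` {m. m < length w \<and> w ! m = J}"
      by (intro image_eqI[of _ _ "n - 1"]) (auto simp: ps_def)
  qed (auto simp: ps_def)
  have dist: "distinct ps" by (simp add: ps_def)
  have len: "length ps = count_list w J"
    using distinct_card[OF dist] by (simp add: set_ps card_image count_list_conv_card)
  have "(\<Sum>t=1..count_list w J. letter_pos w J t) = (\<Sum>t<length ps. ps ! t)"
    unfolding len letter_pos_def ps_def[symmetric]
    by (rule sum.reindex_bij_witness[of _ Suc "\<lambda>t. t - 1"]) auto
  also have "\<dots> = sum_list ps"
    by (simp add: sum_list_sum_nth atLeast0LessThan)
  also have "\<dots> = \<Sum>(set ps)"
    using sum_list_distinct_conv_sum_set[OF dist, of id] by simp
  also have "\<dots> = (\<Sum>m | m < length w \<and> w ! m = J. m + 1)"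
    by (simp add: set_ps sum.reindex)
  finally show ?thesis .
qed

lemma sum_Z_dealing_word:
  assumes "is_dealing_word s w"
  shows "(\<Sum>J\<in>UNIV. real_of_int (Z w I J)) =
    real s * (4 * real s + 1) - 2 * (\<Sum>t=1..s. real (letter_pos w I t))"
proof -
  let ?P = "{m. m < length w \<and> w ! m = I}"
  have len: "length w = 4 * s" and card: "card ?P = s"
    using assms unfolding is_dealing_word_def count_list_conv_card by auto
  have "(\<Sum>J\<in>UNIV. real_of_int (Z w I J)) = real_of_int (\<Sum>J\<in>UNIV. Z w I J)"
    by simp
  \<comment> \<open>\<open>4s - 1 - 2m\<close> is rewritten as \<open>(4s + 1) - 2(m + 1)\<close>,
    since \<open>m + 1\<close> is the position counted from 1.\<close>
  also have "\<dots> = (\<Sum>m\<in>?P. real (4 * s) + 1 - 2 * real (m + 1))"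
    by (simp add: sum_Z_UNIV len diff_diff_eq add.commute)
  also have "\<dots> = real s * (4 * real s + 1) - 2 * real (\<Sum>m\<in>?P. m + 1)"
    by (simp only: sum_subtractf sum_constant sum_distrib_left of_nat_sum card) simp
  also have "(\<Sum>m\<in>?P. m + 1) = (\<Sum>t=1..s. letter_pos w I t)"
    using sum_letter_pos[of w I] assms by (simp add: is_dealing_word_def)
  finally show ?thesis by simp
qed

section \<open>The number of decks giving a hand\<close>

text \<open>Makes sense for words of any length and for any table \<open>f\<close>, as induction on
  the word requires. For a hand in \<open>Omega\<close> and a word of length \<open>4 * s\<close> it
  agrees with \<open>decks_giving\<close>.\<close>

definition deals :: "player list \<Rightarrow> nat set \<Rightarrow> (nat \<Rightarrow> player \<Rightarrow> nat) \<Rightarrow> nat list set" where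
  "deals w C f = {D. length D = length w \<and> set D \<subseteq> C \<and>
     (\<forall>i\<in>C. \<forall>J. cards_received w D i J = f i J)}"

lemma finite_deals: "finite C \<Longrightarrow> finite (deals w C f)"
  by (rule finite_subset[OF _ finite_lists_length_eq[of C "length w"]]) (auto simp: deals_def)

lemma cards_received_Cons:
  "cards_received (I # w) (c # D) i J = of_bool (I = J \<and> c = i) + cards_received w D i J"
proof -
  have "{m. m < length (I # w) \<and> (I # w) ! m = J \<and> (c # D) ! m = i} =
    {m. m = 0 \<and> I = J \<and> c = i} \<union> Suc ` {m. m < length w \<and> w ! m = J \<and> D ! m = i}"
    (is "_ = ?A \<union> _")
    by (auto simp: less_Suc_eq_0_disj image_iff)
  moreover have "card (?A \<union> Suc ` B) = card ?A + card B" if "finite B" for B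
    using that by (subst card_Un_disjoint) (auto simp: card_image)
  moreover have "card ?A = of_bool (I = J \<and> c = i)" by auto
  ultimately show ?thesis
    by (simp add: cards_received_def)
qed

text \<open>The first card goes to \<open>I\<close> and uses up one card of its colour
  \<open>c\<close> in the hand of \<open>I\<close>. The restriction \<open>f c I > 0\<close> guards
  against truncated subtraction, which would turn an entry 0 into 0 again.\<close>

lemma deals_Cons:
  "deals (I # w) C f =
    (\<Union>c\<in>{c\<in>C. f c I > 0}. (#) c ` deals w C (f(c := (f c)(I := f c I - 1))))"
    (is "?L = ?R")
proof (intro equalityI subsetI)
  fix D assume D: "D \<in> ?L"
  then obtain c D' where [simp]: "D = c # D'" by (cases D) (auto simp: deals_def)
  have eq: "of_bool (I = J \<and> c = i) + cards_received w D' i J = f i J" if "i \<in> C" for i J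
    using D that by (simp add: deals_def cards_received_Cons)
  have c: "c \<in> C" using D by (simp add: deals_def)
  have "f c I > 0" using eq[OF c, of I] by simp
  moreover have "D' \<in> deals w C (f(c := (f c)(I := f c I - 1)))"
  proof -
    have "cards_received w D' i J = (f(c := (f c)(I := f c I - 1))) i J" if "i \<in> C" for i J
      using eq[OF that, of J] by (auto simp: of_bool_def split: if_splits)
    with D show ?thesis by (simp add: deals_def)
  qed
  ultimately show "D \<in> ?R" using c by auto
next
  fix D assume "D \<in> ?R"
  then show "D \<in> ?L" by (auto simp: deals_def cards_received_Cons of_bool_def)
qed

text \<open>A product of one multinomial coefficient per player, stated without division so that it
  stays in the natural numbers. In the induction, a first card of colour \<open>c\<close> dealt to
  \<open>I\<close> costs the factor \<open>f c I\<close> in the product of factorials; these factors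
  add up to the number of letters \<open>I\<close>, which is what turns the factorial for
  \<open>w\<close> into the one for \<open>I # w\<close>.\<close>

lemma card_deals:
  assumes "finite C" and "\<And>J. (\<Sum>i\<in>C. f i J) = count_list w J"
  shows "card (deals w C f) * (\<Prod>i\<in>C. \<Prod>J\<in>UNIV. fact (f i J)) =
    (\<Prod>J\<in>UNIV. fact (count_list w J) :: nat)"
  using assms(2)
proof (induction w arbitrary: f)
  case Nil
  then have "f i J = 0" if "i \<in> C" for i J using that assms(1) by simp
  moreover from this have "deals [] C f = {[]}" by (auto simp: deals_def cards_received_def)
  ultimately show ?case by simp
next
  case (Cons I w)
  let ?f = "\<lambda>c. f(c := (f c)(I := f c I - 1))"
  let ?A = "{c\<in>C. f c I > 0}"
  let ?F = "\<lambda>f. \<Prod>i\<in>C. \<Prod>J\<in>UNIV. fact (f i J) :: nat"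
  let ?W = "\<Prod>J\<in>UNIV. fact (count_list w J) :: nat"
  have step: "card (deals w C (?f c)) * ?F f = ?W * f c I" if c: "c \<in> ?A" for c
  proof -
    have "(\<Sum>i\<in>C. ?f c i J) = count_list w J" for J
    proof -
      have "(\<Sum>i\<in>C. f i J) = (\<Sum>i\<in>C. ?f c i J) + of_bool (I = J)"
        using c assms(1) by (subst (1 2) sum.remove[of C c]) auto
      with Cons.prems[of J] show ?thesis by (simp split: if_splits)
    qed
    from Cons.IH[OF this] have IH: "card (deals w C (?f c)) * ?F (?f c) = ?W" .
    have "(\<Prod>J\<in>UNIV. fact (f c J)) = (\<Prod>J\<in>UNIV. fact (?f c c J)) * f c I"
      using c by (subst (1 2) prod.remove[of UNIV I]) (auto simp: fact_reduce[of "f c I"])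
    then have "?F f = ?F (?f c) * f c I"
      using c assms(1) by (subst (1 2) prod.remove[of C c]) (auto simp del: fun_upd_apply simp: fun_upd_other)
    with IH show ?thesis by (simp only: mult.assoc[symmetric])
  qed
  have "card (deals (I # w) C f) = (\<Sum>c\<in>?A. card (deals w C (?f c)))"
    unfolding deals_Cons using assms(1)
    by (subst card_UN_disjoint) (auto simp: finite_deals card_image)
  then have "card (deals (I # w) C f) * ?F f = (\<Sum>c\<in>?A. ?W * f c I)"
    by (simp only: sum_distrib_right step cong: sum.cong)
  \<comment> \<open>The colours outside \<open>?A\<close> contribute 0, so the sum may run over all
    of \<open>C\<close>.\<close>
  also have "\<dots> = ?W * (\<Sum>c\<in>C. f c I)"
    using assms(1) unfolding sum_distrib_left by (intro sum.mono_neutral_left) auto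
  also have "\<dots> = ?W * Suc (count_list w I)"
    using Cons.prems[of I] by simp
  also have "\<dots> = (\<Prod>J\<in>UNIV. fact (count_list (I # w) J))"
    by (subst (1 2) prod.remove[of UNIV I]) (auto simp: algebra_simps)
  finally show ?case .
qed

section \<open>Exchange symmetry and joint colour counts\<close>

text \<open>Such a permutation moves cards only within hands. Since
  \<open>permute_list \<pi> D ! m = D ! \<pi> m\<close>, the map \<open>\<pi>\<close> itself is a
  bijection between the positions counted for the two decks.\<close>

lemma permute_list_deals:
  assumes "\<pi> permutes {..<length w}" and "\<And>m. m < length w \<Longrightarrow> w ! \<pi> m = w ! m"
    and "D \<in> deals w C f"
  shows "permute_list \<pi> D \<in> deals w C f"
proof -
  have len: "length D = length w" using assms(3) by (simp add: deals_def)
  have "cards_received w (permute_list \<pi> D) i J = cards_received w D i J" for i J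
    unfolding cards_received_def
  proof (rule bij_betw_same_card[of \<pi>], rule bij_betw_imageI)
    show "inj_on \<pi> {m. m < length w \<and> w ! m = J \<and> permute_list \<pi> D ! m = i}"
      using assms(1) by (meson inj_on_subset permutes_inj subset_UNIV)
    show "\<pi> ` {m. m < length w \<and> w ! m = J \<and> permute_list \<pi> D ! m = i} =
        {m. m < length w \<and> w ! m = J \<and> D ! m = i}"
    proof (intro equalityI subsetI)
      fix n assume n: "n \<in> {m. m < length w \<and> w ! m = J \<and> D ! m = i}"
      obtain m where m: "n = \<pi> m" using permutes_surj[OF assms(1)] by (metis surjD)
      have "m < length w" using permutes_in_image[OF assms(1), of m] n m by simp
      with n m assms(2) show "n \<in> \<pi> ` {m. m < length w \<and> w ! m = J \<and> permute_list \<pi> D ! m = i}"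
        by (auto simp: permute_list_nth[of \<pi> D] assms(1) len)
    next
      fix n assume "n \<in> \<pi> ` {m. m < length w \<and> w ! m = J \<and> permute_list \<pi> D ! m = i}"
      then show "n \<in> {m. m < length w \<and> w ! m = J \<and> D ! m = i}"
        using permutes_in_image[OF assms(1)] assms(2)
        by (auto simp: permute_list_nth[of \<pi> D] assms(1) len)
    qed
  qed
  with assms(1,3) len show ?thesis by (simp add: deals_def)
qed

text \<open>Divided by \<open>card A\<close>, this is the joint distribution of the colours at two
  positions of a uniformly random deck in \<open>A\<close>.\<close>

definition joint :: "nat list set \<Rightarrow> nat \<Rightarrow> nat \<Rightarrow> nat \<Rightarrow> nat \<Rightarrow> nat" where
  "joint A u v m n = card {D\<in>A. D ! m = u \<and> D ! n = v}"

text \<open>Exchanging the cards at \<open>a\<close> and \<open>b\<close> is an involution on the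
  decks, and it carries the decks counted on one side to those counted on the other.\<close>

lemma joint_transpose:
  assumes "a < length w" "b < length w" "w ! a = w ! b" "m < length w" "n < length w"
  shows "joint (deals w C f) u v (transpose a b m) (transpose a b n) = joint (deals w C f) u v m n"
proof -
  let ?t = "transpose a b"
  have perm: "?t permutes {..<length w}" using assms(1,2) by (simp add: permutes_swap_id)
  have w: "w ! ?t i = w ! i" for i using assms(3) by (auto simp: transpose_def)
  have inv: "permute_list ?t (permute_list ?t D) = D" if "D \<in> deals w C f" for D
    using that perm by (simp add: deals_def permute_list_compose[symmetric])
  have nth: "permute_list ?t D ! i = D ! ?t i" if "D \<in> deals w C f" "i < length w" for D i
    using that perm by (simp add: deals_def permute_list_nth)
  have lt: "?t i < length w" if "i < length w" for i
    using that permutes_in_image[OF perm, of i] by simp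
  note deals = permute_list_deals[OF perm w]
  show ?thesis unfolding joint_def
    by (rule bij_betw_same_card[of "permute_list ?t"],
        rule bij_betw_byWitness[where f' = "permute_list ?t"])
       (use assms(4,5) in \<open>auto simp: inv nth lt deals\<close>)
qed

text \<open>Here the two exchanged positions are \<open>m\<close> and \<open>n\<close> themselves.
  This is why pairs inside one hand cancel in the sum of \<open>Z\<close>.\<close>

lemma joint_same_player:
  assumes "m < length w" "n < length w" "w ! m = w ! n"
  shows "joint (deals w C f) u v m n = joint (deals w C f) u v n m"
  using joint_transpose[of m w n n m C f u v] assms by simp

text \<open>Double counting: the joint count is the same for all pairs of positions of
  \<open>I\<close> and \<open>J\<close>, and each deck has \<open>f u I * f v J\<close> such pairs
  with colours \<open>u\<close> and \<open>v\<close>.\<close>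

lemma joint_distinct_players:
  assumes C: "finite C" "u \<in> C" "v \<in> C"
    and mn: "m < length w" "n < length w" "w ! m = I" "w ! n = J" "I \<noteq> J"
  shows "count_list w I * count_list w J * joint (deals w C f) u v m n =
    card (deals w C f) * f u I * f v J"
proof -
  let ?A = "deals w C f"
  let ?P = "\<lambda>J. {m\<in>{..<length w}. w ! m = J}"
  have fin: "finite ?A" by (rule finite_deals[OF C(1)])
  \<comment> \<open>First \<open>m\<close> is exchanged with \<open>m'\<close>, then
    \<open>n\<close> with \<open>n'\<close>. As \<open>I \<noteq> J\<close>, neither exchange
    touches the position dealt to the other player.\<close>
  have joint: "joint ?A u v m' n' = joint ?A u v m n" if "m' \<in> ?P I" "n' \<in> ?P J" for m' n'
    using joint_transpose[of m w m' m n C f u v] joint_transpose[of n w n' m' n C f u v] mn that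
    by (auto simp: transpose_def split: if_splits)
  have f: "(\<Sum>m\<in>?P J. of_bool (D ! m = i)) = f i J" if "D \<in> ?A" "i \<in> C" for D i J
  proof -
    have "f i J = card {m\<in>?P J. D ! m = i}"
      using that by (simp add: deals_def cards_received_def conj_assoc)
    then show ?thesis using card_conv_sum_of_bool[of "?P J" "\<lambda>m. D ! m = i", where 'a=nat] by simp
  qed
  have "count_list w I * count_list w J * joint ?A u v m n =
      (\<Sum>m'\<in>?P I. \<Sum>n'\<in>?P J. joint ?A u v m' n')"
    by (simp add: joint count_list_conv_card)
  also have "\<dots> = (\<Sum>m'\<in>?P I. \<Sum>n'\<in>?P J. \<Sum>D\<in>?A. of_bool (D ! m' = u \<and> D ! n' = v))"
    unfolding joint_def using card_conv_sum_of_bool[OF fin, where 'a=nat] by simp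
  also have "\<dots> = (\<Sum>D\<in>?A. \<Sum>m'\<in>?P I. \<Sum>n'\<in>?P J. of_bool (D ! m' = u \<and> D ! n' = v))"
    by (rule sym, subst sum.swap, rule sum.cong[OF refl], rule sum.swap)
  also have "\<dots> = (\<Sum>D\<in>?A. (\<Sum>m'\<in>?P I. of_bool (D ! m' = u)) * (\<Sum>n'\<in>?P J. of_bool (D ! n' = v)))"
    by (simp only: sum_product of_bool_conj)
  also have "\<dots> = (\<Sum>D\<in>?A. f u I * f v J)"
    by (intro sum.cong refl) (simp only: f C)
  finally show ?thesis by (simp add: mult.assoc)
qed

section \<open>From pairs of colours in decks to pairs of players in the word\<close>

lemma sum_Z_deals:
  assumes "finite C" "u \<in> C" "v \<in> C" and s: "\<And>J. count_list w J = s"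
  shows "real s ^ 2 * (\<Sum>D\<in>deals w C f. real_of_int (Z D u v)) =
    real (card (deals w C f)) *
      (\<Sum>I\<in>UNIV. \<Sum>J\<in>UNIV. real (f u I) * real (f v J) * real_of_int (Z w I J))"
proof -
  let ?A = "deals w C f"
  let ?N = "real (card ?A)"
  let ?L = "length w"
  have fin: "finite ?A" by (rule finite_deals[OF assms(1)])
  \<comment> \<open>Also true when one player receives both positions: the left side then vanishes
    by exchange, the right side by commutativity.\<close>
  have cross: "real s ^ 2 * (real (joint ?A u v m n) - real (joint ?A u v n m)) =
      ?N * (real (f u (w ! m)) * real (f v (w ! n)) - real (f u (w ! n)) * real (f v (w ! m)))"
    if "m < ?L" "n < ?L" for m n
  proof (cases "w ! m = w ! n")
    case True
    then show ?thesis using joint_same_player[OF that] by simp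
  next
    case False
    have "s * s * joint ?A u v m n = card ?A * f u (w ! m) * f v (w ! n)"
      "s * s * joint ?A u v n m = card ?A * f u (w ! n) * f v (w ! m)"
      using joint_distinct_players[OF assms(1-3), of m w n "w ! m" "w ! n" f]
        joint_distinct_players[OF assms(1-3), of n w m "w ! n" "w ! m" f] that False
      by (simp_all add: s)
    from this[THEN arg_cong[of _ _ real]] show ?thesis
      by (simp add: power2_eq_square algebra_simps)
  qed
  have "(\<Sum>D\<in>?A. real_of_int (Z D u v)) = (\<Sum>D\<in>?A. \<Sum>n<?L. \<Sum>m<n.
      of_bool (D ! m = u \<and> D ! n = v) - of_bool (D ! m = v \<and> D ! n = u))"
    unfolding Z_conv_sum by (intro sum.cong refl) (simp add: deals_def)
  also have "\<dots> = (\<Sum>n<?L. \<Sum>m<n. \<Sum>D\<in>?A.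
      of_bool (D ! m = u \<and> D ! n = v) - of_bool (D ! m = v \<and> D ! n = u))"
    by (rule sum_swap_triangle)
  also have "\<dots> = (\<Sum>n<?L. \<Sum>m<n. real (joint ?A u v m n) - real (joint ?A u v n m))"
    unfolding joint_def by (simp add: card_conv_sum_of_bool fin sum_subtractf conj_commute)
  finally have "real s ^ 2 * (\<Sum>D\<in>?A. real_of_int (Z D u v)) =
      (\<Sum>n<?L. \<Sum>m<n. real s ^ 2 * (real (joint ?A u v m n) - real (joint ?A u v n m)))"
    by (simp only: sum_distrib_left)
  also have "\<dots> = ?N * (\<Sum>n<?L. \<Sum>m<n.
      real (f u (w ! m)) * real (f v (w ! n)) - real (f u (w ! n)) * real (f v (w ! m)))"
    unfolding sum_distrib_left by (intro sum.cong refl cross) auto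
  \<comment> \<open>The players at \<open>m\<close> and \<open>n\<close> are replaced by indicator
    sums over \<open>I\<close> and \<open>J\<close>, so that after interchanging the sums the inner
    triangular sum is \<open>Z w I J\<close>.\<close>
  also have "(\<Sum>n<?L. \<Sum>m<n.
      real (f u (w ! m)) * real (f v (w ! n)) - real (f u (w ! n)) * real (f v (w ! m))) =
    (\<Sum>n<?L. \<Sum>m<n. \<Sum>I\<in>UNIV. \<Sum>J\<in>UNIV. real (f u I) * real (f v J) *
      (of_bool (w ! m = I \<and> w ! n = J) - of_bool (w ! m = J \<and> w ! n = I)))"
  proof (intro sum.cong refl)
    have pick: "(\<Sum>I\<in>UNIV. \<Sum>J\<in>UNIV. real (f u I) * real (f v J) * of_bool (x = I \<and> y = J)) =
      real (f u x) * real (f v y)" for x y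
      by (cases x; cases y) (simp_all add: sum_player)
    show "real (f u (w ! m)) * real (f v (w ! n)) - real (f u (w ! n)) * real (f v (w ! m)) =
      (\<Sum>I\<in>UNIV. \<Sum>J\<in>UNIV. real (f u I) * real (f v J) *
        (of_bool (w ! m = I \<and> w ! n = J) - of_bool (w ! m = J \<and> w ! n = I)))" for m n
      using pick[of "w ! m" "w ! n"] pick[of "w ! n" "w ! m"]
      by (simp only: right_diff_distrib sum_subtractf conj_commute[of "w ! m = _"])
  qed
  also have "\<dots> = (\<Sum>I\<in>UNIV. \<Sum>J\<in>UNIV. \<Sum>n<?L. \<Sum>m<n. real (f u I) * real (f v J) *
      (of_bool (w ! m = I \<and> w ! n = J) - of_bool (w ! m = J \<and> w ! n = I)))"
    by (simp only: sum_swap_triangle)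
  finally show ?thesis
    by (simp only: Z_conv_sum sum_distrib_left)
qed

section \<open>Evaluation for a hand in \<open>Omega\<close>\<close>

text \<open>Each card of colour \<open>i\<close> lies in exactly one hand, so the four entries of
  the hand determine the number of such cards, and membership in \<open>Omega\<close> makes it
  \<open>p i\<close>.\<close>

lemma decks_giving_eq_deals:
  assumes "length w = 4 * s" and "\<omega> \<in> Omega s k p"
  shows "decks_giving s k p w \<omega> = deals w {1..k} \<omega>"
proof -
  have "count_list D i = p i"
    if len: "length D = length w" and i: "i \<in> {1..k}"
      and D: "\<forall>J. cards_received w D i J = \<omega> i J" for D i
  proof -
    have "{m. m < length D \<and> D ! m = i} = (\<Union>J\<in>UNIV. {m. m < length w \<and> w ! m = J \<and> D ! m = i})"
      using len by auto
    then have "count_list D i = (\<Sum>J\<in>UNIV. cards_received w D i J)"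
      unfolding count_list_conv_card cards_received_def
      by (simp only:) (subst card_UN_disjoint, auto)
    then show ?thesis using assms(2) i D by (simp add: sum_player Omega_def)
  qed
  then show ?thesis
    by (auto simp: decks_giving_def deals_def is_deck_def assms(1))
qed

theorem proposition3p1:
  fixes s k :: nat and p :: "nat \<Rightarrow> nat"
    and w :: "player list" and \<omega> :: "nat \<Rightarrow> player \<Rightarrow> nat"
  assumes "s \<ge> 1" and "k \<ge> 2"
    and "\<forall>i\<in>{1..k}. p i \<ge> 1"
    and "(\<Sum>i=1..k. p i) = 4 * s"
    and "is_dealing_word s w"
    and "\<omega> \<in> Omega s k p"
  shows
    "(let B = 1; R = 2;
          b = real (p 1);
          bl = (\<lambda>J. real (\<omega> 1 J));
          q = (\<lambda>J. real (\<Sum>i=3..k. \<omega> i J));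
          z = (\<lambda>I J. real_of_int (Z w I J));
          T = (\<lambda>J. \<Sum>t=1..s. real (letter_pos w J t))
      in
       (\<Sum>D\<in>decks_giving s k p w \<omega>. real_of_int (Z D B R)) =
         fact s ^ 4
         * (\<Prod>i=1..k. 1 / (fact (\<omega> i North) * fact (\<omega> i East) * fact (\<omega> i South) * fact (\<omega> i West)))
         * ((4 * real s + 1) * b
            + bl North / real s *
                ((q East * z East North + q South * z South North + q West * z West North) / real s
                 - 2 * T North)
            + bl East / real s *
                ((q North * z North East + q South * z South East + q West * z West East) / real s
                 - 2 * T East)
            + bl South / real s *
                ((q North * z North South + q East * z East South + q West * z West South) / real s
                 - 2 * T South)
            + bl West / real s *
                ((q North * z North West + q East * z East West + q South * z South West) / real s
                 - 2 * T West)))"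
proof -
  let ?A = "deals w {1..k} \<omega>"
  let ?b = "\<lambda>J. real (\<omega> 1 J)"
  let ?q = "\<lambda>J. real (\<Sum>i=3..k. \<omega> i J)"
  let ?z = "\<lambda>I J. real_of_int (Z w I J)"
  let ?T = "\<lambda>J. \<Sum>t=1..s. real (letter_pos w J t)"
  let ?S = "\<Sum>D\<in>?A. real_of_int (Z D 1 2)"
  define N where "N = real (card ?A)"
  have len: "length w = 4 * s" and count: "\<And>J. count_list w J = s"
    using assms(5) by (simp_all add: is_dealing_word_def)
  have hand: "(\<Sum>i=1..k. \<omega> i J) = s" for J
    using assms(6) by (simp add: Omega_def)
  have red: "real (\<omega> 2 J) = real s - ?b J - ?q J" for J
  proof -
    have "{1..k} = insert 1 (insert 2 {3..k})" using assms(2) by auto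
    then have "\<omega> 1 J + \<omega> 2 J + (\<Sum>i=3..k. \<omega> i J) = s" using hand[of J] by simp
    then show ?thesis by linarith
  qed
  have black: "real (p 1) = ?b North + ?b East + ?b South + ?b West"
    using assms(2,6) by (auto simp: Omega_def simp flip: of_nat_add)
  have N: "N = fact s ^ 4 * (\<Prod>i=1..k. 1 / (fact (\<omega> i North) * fact (\<omega> i East)
      * fact (\<omega> i South) * fact (\<omega> i West)))"
  proof -
    have "card ?A * (\<Prod>i=1..k. \<Prod>J\<in>UNIV. fact (\<omega> i J)) = (fact s ^ 4 :: nat)"
      using card_deals[of "{1..k}" \<omega> w, OF finite_atLeastAtMost] hand
      by (simp add: count prod_player eval_nat_numeral mult.assoc del: prod_constant)
    from arg_cong[OF this, of real] show ?thesis
      by (simp add: N_def prod_player prod_dividef field_simps)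
  qed
  have row: "(\<Sum>J\<in>UNIV. ?z I J) = real s * (4 * real s + 1) - 2 * ?T I" for I
    by (rule sum_Z_dealing_word[OF assms(5)])
  have anti: "?z I J = - ?z J I" for I J using Z_antisym[of w I J] by simp
  have cancel: "(\<Sum>I\<in>UNIV. \<Sum>J\<in>UNIV. ?b I * ?b J * ?z I J) = 0"
  proof -
    have "(\<Sum>I\<in>UNIV. \<Sum>J\<in>UNIV. ?b I * ?b J * ?z I J) =
        (\<Sum>I\<in>UNIV. \<Sum>J\<in>UNIV. ?b J * ?b I * ?z J I)" by (rule sum.swap)
    \<comment> \<open>After the names of the players are interchanged, antisymmetry shows that the
      sum equals its own negative.\<close>
    also have "\<dots> = - (\<Sum>I\<in>UNIV. \<Sum>J\<in>UNIV. ?b I * ?b J * ?z I J)"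
      unfolding sum_negf[symmetric] by (subst anti) (simp add: mult_ac)
    finally show ?thesis by simp
  qed
  have "real s ^ 2 * ?S = N * (\<Sum>I\<in>UNIV. \<Sum>J\<in>UNIV. ?b I * real (\<omega> 2 J) * ?z I J)"
    unfolding N_def using assms(2) by (intro sum_Z_deals) (auto simp: count)
  \<comment> \<open>Red is eliminated by \<open>red\<close>. In the \<open>?q\<close> term
    antisymmetry absorbs the minus sign, which yields \<open>?z J I\<close>, the orientation of the
    claimed formula.\<close>
  also have "(\<Sum>I\<in>UNIV. \<Sum>J\<in>UNIV. ?b I * real (\<omega> 2 J) * ?z I J) =
      (\<Sum>I\<in>UNIV. \<Sum>J\<in>UNIV. real s * ?b I * ?z I J + ?b I * ?q J * ?z J I - ?b I * ?b J * ?z I J)"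
    unfolding red by (intro sum.cong refl, subst (2) anti) (simp add: algebra_simps)
  also have "\<dots> = (\<Sum>I\<in>UNIV. \<Sum>J\<in>UNIV. real s * ?b I * ?z I J)
      + (\<Sum>I\<in>UNIV. \<Sum>J\<in>UNIV. ?b I * ?q J * ?z J I)"
    by (simp only: sum.distrib sum_subtractf cancel diff_zero)
  also have "\<dots> = (\<Sum>I\<in>UNIV. real s * ?b I * (real s * (4 * real s + 1) - 2 * ?T I)
      + ?b I * (\<Sum>J\<in>UNIV. ?q J * ?z J I))"
    by (simp only: sum.distrib sum_distrib_left[symmetric] row mult.assoc)
  finally have main: "real s ^ 2 * ?S = N * \<dots>" .
  \<comment> \<open>The claimed formula lists only the three other players for each
    \<open>I\<close>; this removes the fourth term of the sum over all players.\<close>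
  have diag: "?z I I = 0" for I by (simp add: Z_def)
  have s: "real s \<noteq> 0" using assms(1) by simp
  have "?S = N * (\<Sum>I\<in>UNIV. (4 * real s + 1) * ?b I
      + ?b I / real s * ((\<Sum>J\<in>UNIV. ?q J * ?z J I) / real s - 2 * ?T I))" (is "_ = N * ?R")
  proof -
    \<comment> \<open>The factor \<open>s ^ 2\<close> is cleared: one \<open>s\<close> comes from
      the row sum and one from the size of the red complement, which leaves
      \<open>(4 * real s + 1) * ?b I\<close>, whose sum over the players is
      \<open>(4 * real s + 1) * b\<close>.\<close>
    have "real s ^ 2 * ?R = (\<Sum>I\<in>UNIV. real s * ?b I * (real s * (4 * real s + 1) - 2 * ?T I)
        + ?b I * (\<Sum>J\<in>UNIV. ?q J * ?z J I))"
      unfolding sum_distrib_left[of "real s ^ 2"] using s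
      by (intro sum.cong refl) (simp add: field_simps power2_eq_square)
    with main have "real s ^ 2 * ?S = real s ^ 2 * (N * ?R)" by (simp only: mult.left_commute)
    with s show ?thesis by simp
  qed
  then show ?thesis
    unfolding Let_def decks_giving_eq_deals[OF len assms(6)] N[symmetric] black sum_player diag
    by (simp add: algebra_simps)
qed

end
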